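(* Let $G_i=(V_i,E_i)$, $i=1,2$, be simple graphs. For each ${\rm t}\in\{{\rm loc},{\rm q},{\rm qa},{\rm qc},{\rm C}^*,A^*\}$, if $\mathrm{HypIso}(G_1,G_2)$ has a perfect ${\rm t}$-strategy, then $\mathrm{Iso}(G_1,G_2)$ has a perfect ${\rm t}$-strategy.
   Context: Algebras are over $\mathbb C$. Correlations and games. For finite sets $X,Y,A,B$, a correlation is a family $p=\{p(a,b|x,y)\}$ of conditional probability distributions on $A\times B$. A POVM is a finite family of positive operators summing to $I$. $p\in\mathcal C_{\rm qc}$ if $p(a,b|x,y)=\langle E_{x,a}F_{y,b}\xi,\xi\rangle$ for a Hilbert space $H$, a unit vector $\xi\in H$ and POVMs $(E_{x,a})_a$, $(F_{y,b})_b$ on $H$ with $E_{x,a}F_{y,b}=F_{y,b}E_{x,a}$; $p\in\mathcal C_{\rm q}$ if moreover $H=H_A\otimes H_B$ is finite-dimensional with $E_{x,a}=E'_{x,a}\otimes I$, $F_{y,b}=I\otimes F'_{y,b}$; $\mathcal C_{\rm qa}$ is the closure of $\mathcal C_{\rm q}$; $p\in\mathcal C_{\rm loc}$ if it is a finite convex combination of products $p^1(a|x)p^2(b|y)$ of conditional distributions. A non-local game is $\mathcal G=(X,Y,A,B,\lambda)$ with $\lambda:X\times Y\times A\times B\to\{0,1\}$; for ${\rm t}\in\{{\rm loc,q,qa,qc}\}$ a perfect ${\rm t}$-strategy is $p\in\mathcal C_{\rm t}$ with $p(a,b|x,y)=0$ whenever $\lambda(x,y,a,b)=0$. For a synchronous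 game ($X=Y$, $A=B$), $\mathcal A(\mathcal G)$ is the universal unital $*$-algebra generated by $\{e_{x,a}\}$ with $e_{x,a}=e_{x,a}^*=e_{x,a}^2$, $\sum_ae_{x,a}=1$, and $e_{x,a}e_{y,b}=0$ whenever $\lambda(x,y,a,b)=0$; $\mathcal G$ has a perfect $A^*$-strategy if $\mathcal A(\mathcal G)\ne0$, and a perfect ${\rm C}^*$-strategy if $\mathcal A(\mathcal G)$ has a unital $*$-representation into $\mathcal B(H)$ for some non-zero Hilbert space $H$. Hypergraphs. A hypergraph $\Lambda=(V,E)$ consists of a finite set $V$ and a finite non-empty family $E$ of hyperedges (subsets of $V$); all hypergraphs are assumed full (every vertex lies in a hyperedge). A finite simple graph is regarded as a hypergraph whose hyperedges are its edges. $\mathrm{HypIso}(\Lambda_1,\Lambda_2)$, $\Lambda_i=(V_i,E_i)$: all question and answer sets are $V_1\sqcup V_2\sqcup E_1\sqcup E_2$, and $\lambda(x,y,a,b)=1$ iff: (i) if $x\in V_i$ then $a\in V_{3-i}$, if $x\in E_i$ then $a\in E_{3-i}$, and similarly for $(y,b)$; (ii) if $x\in V_i$ and $y\in E_i$, then $x\in y\iff a\in b$; (iii) if $x,y$ are both vertices, let $v_A,w_A$ be the elements of $\{x,a\}$ in $V_1,V_2$ and $v_B,w_B$ those of $\{y,b\}$ in $V_1,V_2$; the relation between $v_A,v_B$ in $\Lambda_1$ (equal / distinct and in a common hyperedge / distinct and in no common hyperedge) is the same as that between $w_A,w_B$ in $\Lambda_2$; (iv) if $x,y$ are both hyperedges,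 with the analogous notation $e_A,e_B\in E_1$, $f_A,f_B\in E_2$, the relation between $e_A,e_B$ (equal / distinct and intersecting / disjoint) is the same as that between $f_A,f_B$. $\mathrm{Iso}(G_1,G_2)$ (graph isomorphism game): all question and answer sets are $V_1\sqcup V_2$; the players win iff each answers with a vertex of the opposite graph to the one containing the question received and, with $v_A,v_B,w_A,w_B$ as in (iii), the relation between $v_A,v_B$ in $G_1$ (equal / distinct adjacent / distinct non-adjacent) is the same as that between $w_A,w_B$ in $G_2$. *)

theory Defs
  imports
    "HOL-Analysis.Function_Topology"
    "HOL-Library.Poly_Mapping"
    "HOL-Algebra.QuotRing"
    "Jordan_Normal_Form.Matrix"
begin

section \<open>Complex Hilbert spaces and bounded operators\<close>

text \<open>
  HOL-Analysis only has real inner product spaces. Completeness is inherited from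
  \<^class>\<open>banach\<close>. The inner product is linear in its first argument.
\<close>

class complex_hilbert_space = banach +
  fixes scaleC :: "complex \<Rightarrow> 'a \<Rightarrow> 'a"
    and cinner :: "'a \<Rightarrow> 'a \<Rightarrow> complex"
  assumes scaleC_add_right: "scaleC c (x + y) = scaleC c x + scaleC c y"
    and scaleC_add_left: "scaleC (c + d) x = scaleC c x + scaleC d x"
    and scaleC_scaleC: "scaleC c (scaleC d x) = scaleC (c * d) x"
    and scaleC_of_real: "scaleC (complex_of_real r) x = scaleR r x"
    and cinner_commute: "cinner x y = cnj (cinner y x)"
    and cinner_add_left: "cinner (x + y) z = cinner x z + cinner y z"
    and cinner_scaleC_left: "cinner (scaleC c x) y = c * cinner x y"
    and cinner_norm: "cinner x x = complex_of_real ((norm x)\<^sup>2)"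

instantiation complex :: complex_hilbert_space
begin

definition scaleC_complex :: "complex \<Rightarrow> complex \<Rightarrow> complex"
  where "scaleC_complex c x = c * x"

definition cinner_complex :: "complex \<Rightarrow> complex \<Rightarrow> complex"
  where "cinner_complex x y = x * cnj y"

instance
  by standard
    (auto simp: scaleC_complex_def cinner_complex_def algebra_simps scaleR_conv_of_real
      complex_norm_square simp flip: complex_norm_square)

end

definition bounded_clinear :: "('h::complex_hilbert_space \<Rightarrow> 'h) \<Rightarrow> bool"
  where "bounded_clinear T \<longleftrightarrow>
    bounded_linear T \<and> (\<forall>c v. T (scaleC c v) = scaleC c (T v))"

text \<open>Here and below, \<^term>\<open>(0::complex) \<le> z\<close> says that \<^term>\<open>z\<close> is real and non-negative.\<close>

definition positive_operator :: "('h::complex_hilbert_space \<Rightarrow> 'h) \<Rightarrow> bool"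
  where "positive_operator T \<longleftrightarrow> bounded_clinear T \<and> (\<forall>v. 0 \<le> cinner (T v) v)"

definition povm :: "'a set \<Rightarrow> ('a \<Rightarrow> 'h::complex_hilbert_space \<Rightarrow> 'h) \<Rightarrow> bool"
  where "povm A E \<longleftrightarrow>
    (\<forall>a\<in>A. positive_operator (E a)) \<and> (\<lambda>v. \<Sum>a\<in>A. E a v) = (\<lambda>v. v)"


section \<open>Operators on finite-dimensional Hilbert spaces\<close>

definition positive_matrix :: "nat \<Rightarrow> complex mat \<Rightarrow> bool"
  where "positive_matrix n T \<longleftrightarrow>
    T \<in> carrier_mat n n \<and> (\<forall>v\<in>carrier_vec n. 0 \<le> (T *\<^sub>v v) \<bullet>c v)"

definition povm_matrix :: "nat \<Rightarrow> 'a set \<Rightarrow> ('a \<Rightarrow> complex mat) \<Rightarrow> bool"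
  where "povm_matrix n A E \<longleftrightarrow>
    (\<forall>a\<in>A. positive_matrix n (E a)) \<and>
    Matrix.mat n n (\<lambda>(i, j). \<Sum>a\<in>A. E a $$ (i, j)) = 1\<^sub>m n"

text \<open>
  Kronecker product: the basis vector \<open>e\<^sub>i \<otimes> e\<^sub>j\<close> of \<open>\<complex>\<^sup>m \<otimes> \<complex>\<^sup>n\<close> is identified with
  the basis vector of \<open>\<complex>\<^sup>m\<^sup>n\<close> with index \<open>i * n + j\<close>.
\<close>

definition tensor_mat :: "complex mat \<Rightarrow> complex mat \<Rightarrow> complex mat"
  where "tensor_mat S T = Matrix.mat (dim_row S * dim_row T) (dim_col S * dim_col T)
    (\<lambda>(i, j). S $$ (i div dim_row T, j div dim_col T) * T $$ (i mod dim_row T, j mod dim_col T))"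


section \<open>Correlations\<close>

text \<open>
  The number \<open>p(a, b | x, y)\<close> is written \<^term>\<open>p x y a b\<close>. Only its values for
  \<open>x \<in> X\<close>, \<open>y \<in> Y\<close>, \<open>a \<in> A\<close>, \<open>b \<in> B\<close> are constrained.
\<close>

type_synonym ('x, 'y, 'a, 'b) correlation = "'x \<Rightarrow> 'y \<Rightarrow> 'a \<Rightarrow> 'b \<Rightarrow> real"

definition correlations ::
  "'x set \<Rightarrow> 'y set \<Rightarrow> 'a set \<Rightarrow> 'b set \<Rightarrow> ('x, 'y, 'a, 'b) correlation set"
  where "correlations X Y A B = {p. \<forall>x\<in>X. \<forall>y\<in>Y.
    (\<forall>a\<in>A. \<forall>b\<in>B. 0 \<le> p x y a b) \<and> (\<Sum>a\<in>A. \<Sum>b\<in>B. p x y a b) = 1}"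

definition conditional_distribution :: "'x set \<Rightarrow> 'a set \<Rightarrow> ('x \<Rightarrow> 'a \<Rightarrow> real) \<Rightarrow> bool"
  where "conditional_distribution X A q \<longleftrightarrow>
    (\<forall>x\<in>X. (\<forall>a\<in>A. 0 \<le> q x a) \<and> (\<Sum>a\<in>A. q x a) = 1)"

definition C_loc ::
  "'x set \<Rightarrow> 'y set \<Rightarrow> 'a set \<Rightarrow> 'b set \<Rightarrow> ('x, 'y, 'a, 'b) correlation set"
  where "C_loc X Y A B = {p \<in> correlations X Y A B.
    \<exists>(N::nat) w p1 p2.
      (\<forall>i<N. 0 \<le> w i) \<and> (\<Sum>i<N. w i) = 1 \<and>
      (\<forall>i<N. conditional_distribution X A (p1 i) \<and> conditional_distribution Y B (p2 i)) \<and>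
      (\<forall>x\<in>X. \<forall>y\<in>Y. \<forall>a\<in>A. \<forall>b\<in>B. p x y a b = (\<Sum>i<N. w i * (p1 i x a * p2 i y b)))}"

text \<open>
  Every finite-dimensional Hilbert space is unitarily equivalent to some \<open>\<complex>\<^sup>n\<close>, so it suffices
  to let \<open>H\<^sub>A = \<complex>\<^sup>m\<close> and \<open>H\<^sub>B = \<complex>\<^sup>n\<close>.
\<close>

definition C_q ::
  "'x set \<Rightarrow> 'y set \<Rightarrow> 'a set \<Rightarrow> 'b set \<Rightarrow> ('x, 'y, 'a, 'b) correlation set"
  where "C_q X Y A B = {p \<in> correlations X Y A B.
    \<exists>m n (\<xi> :: complex Matrix.vec) E F.
      \<xi> \<in> carrier_vec (m * n) \<and> \<xi> \<bullet>c \<xi> = 1 \<and>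
      (\<forall>x\<in>X. povm_matrix m A (E x)) \<and> (\<forall>y\<in>Y. povm_matrix n B (F y)) \<and>
      (\<forall>x\<in>X. \<forall>y\<in>Y. \<forall>a\<in>A. \<forall>b\<in>B. complex_of_real (p x y a b) =
        ((tensor_mat (E x a) (1\<^sub>m n) * tensor_mat (1\<^sub>m m) (F y b)) *\<^sub>v \<xi>) \<bullet>c \<xi>)}"

text \<open>The closure is taken in the topology of pointwise convergence.\<close>

definition C_qa ::
  "'x set \<Rightarrow> 'y set \<Rightarrow> 'a set \<Rightarrow> 'b set \<Rightarrow> ('x, 'y, 'a, 'b) correlation set"
  where "C_qa X Y A B = closure (C_q X Y A B)"

text \<open>
  HOL cannot quantify over types inside a formula, so the Hilbert space is a type parameter.
  Statements that are polymorphic in \<^typ>\<open>'h\<close> range over all Hilbert spaces; the set of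
  quantum commuting correlations is the union of \<open>C_qc TYPE('h)\<close> over all \<^typ>\<open>'h\<close>.
\<close>

definition C_qc :: "'h::complex_hilbert_space itself \<Rightarrow>
    'x set \<Rightarrow> 'y set \<Rightarrow> 'a set \<Rightarrow> 'b set \<Rightarrow> ('x, 'y, 'a, 'b) correlation set"
  where "C_qc H X Y A B = {p \<in> correlations X Y A B.
    \<exists>(\<xi> :: 'h) E F.
      norm \<xi> = 1 \<and>
      (\<forall>x\<in>X. povm A (E x)) \<and> (\<forall>y\<in>Y. povm B (F y)) \<and>
      (\<forall>x\<in>X. \<forall>y\<in>Y. \<forall>a\<in>A. \<forall>b\<in>B. E x a \<circ> F y b = F y b \<circ> E x a) \<and>
      (\<forall>x\<in>X. \<forall>y\<in>Y. \<forall>a\<in>A. \<forall>b\<in>B.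
        complex_of_real (p x y a b) = cinner (E x a (F y b \<xi>)) \<xi>)}"


section \<open>Non-local games\<close>

record ('x, 'y, 'a, 'b) game =
  Questions_A :: "'x set"
  Questions_B :: "'y set"
  Answers_A :: "'a set"
  Answers_B :: "'b set"
  wins :: "'x \<Rightarrow> 'y \<Rightarrow> 'a \<Rightarrow> 'b \<Rightarrow> bool"

text \<open>Synchronous games have \<open>Questions_A = Questions_B\<close> and \<open>Answers_A = Answers_B\<close>.\<close>

type_synonym ('x, 'a) sync_game = "('x, 'x, 'a, 'a) game"

definition perfect_for ::
  "('x, 'y, 'a, 'b) game \<Rightarrow> ('x, 'y, 'a, 'b) correlation set \<Rightarrow> ('x, 'y, 'a, 'b) correlation set"
  where "perfect_for G C = {p \<in> C.
    \<forall>x\<in>Questions_A G. \<forall>y\<in>Questions_B G. \<forall>a\<in>Answers_A G. \<forall>b\<in>Answers_B G.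
      \<not> wins G x y a b \<longrightarrow> p x y a b = 0}"


section \<open>The unital *-algebra of a synchronous game\<close>

text \<open>
  The free unital *-algebra on a set \<open>S\<close> is the complex monoid algebra of the free monoid over
  the letters \<open>g\<close> and \<open>g*\<close> with \<open>g \<in> S\<close>. Words are written additively, because
  \<^typ>\<open>'w \<Rightarrow>\<^sub>0 complex\<close> is the monoid algebra of an additive monoid.
\<close>

datatype 'g letter = Gen 'g | Star 'g

datatype 'g word = Word "'g letter list"

instantiation word :: (type) monoid_add
begin

definition zero_word :: "'a word"
  where "zero_word = Word []"

fun plus_word :: "'a word \<Rightarrow> 'a word \<Rightarrow> 'a word"
  where "plus_word (Word u) (Word v) = Word (u @ v)"

instance
proof
  fix u v w :: "'a word"
  show "u + v + w = u + (v + w)"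
    by (cases u; cases v; cases w) simp
  show "0 + u = u" "u + 0 = u"
    by (cases u; simp add: zero_word_def)+
qed

end

fun star_letter :: "'g letter \<Rightarrow> 'g letter"
  where
    "star_letter (Gen g) = Star g"
  | "star_letter (Star g) = Gen g"

fun star_word :: "'g word \<Rightarrow> 'g word"
  where "star_word (Word u) = Word (rev (map star_letter u))"

type_synonym 'g free_elem = "'g word \<Rightarrow>\<^sub>0 complex"

definition free_star :: "'g free_elem \<Rightarrow> 'g free_elem"
  where "free_star p = (\<Sum>w\<in>Poly_Mapping.keys p.
    Poly_Mapping.single (star_word w) (cnj (Poly_Mapping.lookup p w)))"

definition scalar :: "complex \<Rightarrow> 'g free_elem"
  where "scalar c = Poly_Mapping.single 0 c"

definition gen :: "'x \<Rightarrow> 'a \<Rightarrow> ('x \<times> 'a) free_elem"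
  where "gen x a = Poly_Mapping.single (Word [Gen (x, a)]) 1"

definition free_star_algebra :: "'g set \<Rightarrow> 'g free_elem ring"
  where "free_star_algebra S =
    \<lparr>carrier = {p. \<forall>w\<in>Poly_Mapping.keys p. set_word w \<subseteq> S},
     monoid.mult = (*), one = 1, zero = 0, add = (+)\<rparr>"

definition game_free_algebra :: "('x, 'a) sync_game \<Rightarrow> ('x \<times> 'a) free_elem ring"
  where "game_free_algebra G = free_star_algebra (Questions_A G \<times> Answers_A G)"

definition game_relations :: "('x, 'a) sync_game \<Rightarrow> ('x \<times> 'a) free_elem set"
  where "game_relations G =
    {gen x a - free_star (gen x a) | x a. x \<in> Questions_A G \<and> a \<in> Answers_A G} \<union>
    {gen x a - gen x a * gen x a | x a. x \<in> Questions_A G \<and> a \<in> Answers_A G} \<union>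
    {(\<Sum>a\<in>Answers_A G. gen x a) - 1 | x. x \<in> Questions_A G} \<union>
    {gen x a * gen y b | x y a b. x \<in> Questions_A G \<and> y \<in> Questions_B G \<and>
      a \<in> Answers_A G \<and> b \<in> Answers_B G \<and> \<not> wins G x y a b}"

text \<open>The two-sided *-ideal generated by the relations, and the quotient by it.\<close>

definition game_ideal :: "('x, 'a) sync_game \<Rightarrow> ('x \<times> 'a) free_elem set"
  where "game_ideal G =
    \<Inter>{I. ideal I (game_free_algebra G) \<and> free_star ` I \<subseteq> I \<and> game_relations G \<subseteq> I}"

definition game_algebra :: "('x, 'a) sync_game \<Rightarrow> ('x \<times> 'a) free_elem set ring"
  where "game_algebra G = game_free_algebra G Quot game_ideal G"

text \<open>
  Elements of the quotient are cosets. The involution acts elementwise (the ideal being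
  *-invariant), and multiplication by a scalar is multiplication by the coset of a constant.
\<close>

definition unital_star_representation ::
  "('x, 'a) sync_game \<Rightarrow> (('x \<times> 'a) free_elem set \<Rightarrow> 'h::complex_hilbert_space \<Rightarrow> 'h) \<Rightarrow> bool"
  where "unital_star_representation G \<pi> \<longleftrightarrow>
    (let \<A> = game_algebra G in
      (\<forall>u\<in>carrier \<A>. bounded_clinear (\<pi> u)) \<and>
      \<pi> \<one>\<^bsub>\<A>\<^esub> = id \<and>
      (\<forall>u\<in>carrier \<A>. \<forall>v\<in>carrier \<A>. \<pi> (u \<oplus>\<^bsub>\<A>\<^esub> v) = (\<lambda>\<xi>. \<pi> u \<xi> + \<pi> v \<xi>)) \<and>
      (\<forall>u\<in>carrier \<A>. \<forall>v\<in>carrier \<A>. \<pi> (u \<otimes>\<^bsub>\<A>\<^esub> v) = \<pi> u \<circ> \<pi> v) \<and>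
      (\<forall>c. \<forall>u\<in>carrier \<A>.
        \<pi> ((game_ideal G +>\<^bsub>game_free_algebra G\<^esub> scalar c) \<otimes>\<^bsub>\<A>\<^esub> u) = (\<lambda>\<xi>. scaleC c (\<pi> u \<xi>))) \<and>
      (\<forall>u\<in>carrier \<A>. \<forall>\<xi> \<eta>. cinner (\<pi> (free_star ` u) \<xi>) \<eta> = cinner \<xi> (\<pi> u \<eta>)))"


section \<open>Perfect strategies\<close>

datatype strategy_type = T_loc | T_q | T_qa | T_qc | T_Cstar | T_Astar

text \<open>The parameter \<^typ>\<open>'h\<close> is used by the types \<open>T_qc\<close> and \<open>T_Cstar\<close> only.\<close>

fun has_perfect_strategy ::
  "'h::complex_hilbert_space itself \<Rightarrow> strategy_type \<Rightarrow> ('x, 'a) sync_game \<Rightarrow> bool"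
  where
    "has_perfect_strategy H T_loc G \<longleftrightarrow>
      perfect_for G (C_loc (Questions_A G) (Questions_B G) (Answers_A G) (Answers_B G)) \<noteq> {}"
  | "has_perfect_strategy H T_q G \<longleftrightarrow>
      perfect_for G (C_q (Questions_A G) (Questions_B G) (Answers_A G) (Answers_B G)) \<noteq> {}"
  | "has_perfect_strategy H T_qa G \<longleftrightarrow>
      perfect_for G (C_qa (Questions_A G) (Questions_B G) (Answers_A G) (Answers_B G)) \<noteq> {}"
  | "has_perfect_strategy H T_qc G \<longleftrightarrow>
      perfect_for G (C_qc H (Questions_A G) (Questions_B G) (Answers_A G) (Answers_B G)) \<noteq> {}"
  | "has_perfect_strategy H T_Cstar G \<longleftrightarrow>
      (\<exists>\<xi>::'h. \<xi> \<noteq> 0) \<and>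
      (\<exists>\<pi> :: ('x \<times> 'a) free_elem set \<Rightarrow> 'h \<Rightarrow> 'h. unital_star_representation G \<pi>)"
  | "has_perfect_strategy H T_Astar G \<longleftrightarrow>
      carrier (game_algebra G) \<noteq> {\<zero>\<^bsub>game_algebra G\<^esub>}"


section \<open>Hypergraphs, graphs and their isomorphism games\<close>

definition hypergraph :: "'v set \<Rightarrow> 'v set set \<Rightarrow> bool"
  where "hypergraph V E \<longleftrightarrow> finite V \<and> E \<noteq> {} \<and> E \<subseteq> Pow V \<and> \<Union>E = V"

definition simple_graph :: "'v set \<Rightarrow> 'v set set \<Rightarrow> bool"
  where "simple_graph V E \<longleftrightarrow> finite V \<and> (\<forall>e\<in>E. e \<subseteq> V \<and> card e = 2)"

datatype relation = Equal | Related | Unrelated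

definition vertex_relation :: "'v set set \<Rightarrow> 'v \<Rightarrow> 'v \<Rightarrow> relation"
  where "vertex_relation E v w =
    (if v = w then Equal else if \<exists>e\<in>E. v \<in> e \<and> w \<in> e then Related else Unrelated)"

definition edge_relation :: "'v set \<Rightarrow> 'v set \<Rightarrow> relation"
  where "edge_relation e f =
    (if e = f then Equal else if e \<inter> f \<noteq> {} then Related else Unrelated)"

definition adjacency_relation :: "'v set set \<Rightarrow> 'v \<Rightarrow> 'v \<Rightarrow> relation"
  where "adjacency_relation E v w =
    (if v = w then Equal else if {v, w} \<in> E then Related else Unrelated)"

text \<open>
  The summands of a disjoint union belong to \<open>\<Lambda>\<^sub>1\<close> (left) and \<open>\<Lambda>\<^sub>2\<close> (right). If \<open>x\<close> and \<open>a\<close> lie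
  on opposite sides, \<open>left_of x a\<close> and \<open>right_of x a\<close> are the elements of \<open>{x, a}\<close> on the left and on
  the right.
\<close>

definition opposite :: "'v + 'w \<Rightarrow> 'v + 'w \<Rightarrow> bool"
  where "opposite x a \<longleftrightarrow> isl x \<noteq> isl a"

definition left_of :: "'v + 'w \<Rightarrow> 'v + 'w \<Rightarrow> 'v"
  where "left_of x a = (if isl x then projl x else projl a)"

definition right_of :: "'v + 'w \<Rightarrow> 'v + 'w \<Rightarrow> 'w"
  where "right_of x a = (if isl x then projr a else projr x)"

fun incident :: "'v + 'w \<Rightarrow> 'v set + 'w set \<Rightarrow> bool"
  where
    "incident (Inl v) (Inl e) \<longleftrightarrow> v \<in> e"
  | "incident (Inr w) (Inr f) \<longleftrightarrow> w \<in> f"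
  | "incident _ _ \<longleftrightarrow> False"

text \<open>
  The outer summands separate vertices (\<^const>\<open>Inl\<close>) from hyperedges (\<^const>\<open>Inr\<close>). Incidence is
  only tested when the vertex is the first player's question and the hyperedge the second
  player's.
\<close>

type_synonym ('v, 'w) hyp_question = "('v + 'w) + ('v set + 'w set)"

fun hyp_iso_rule :: "'v set set \<Rightarrow> 'w set set \<Rightarrow>
    ('v, 'w) hyp_question \<Rightarrow> ('v, 'w) hyp_question \<Rightarrow>
    ('v, 'w) hyp_question \<Rightarrow> ('v, 'w) hyp_question \<Rightarrow> bool"
  where
    "hyp_iso_rule E1 E2 (Inl x) (Inl y) (Inl a) (Inl b) \<longleftrightarrow>
      opposite x a \<and> opposite y b \<and>
      vertex_relation E1 (left_of x a) (left_of y b) = vertex_relation E2 (right_of x a) (right_of y b)"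
  | "hyp_iso_rule E1 E2 (Inl x) (Inr y) (Inl a) (Inr b) \<longleftrightarrow>
      opposite x a \<and> opposite y b \<and>
      (isl x = isl y \<longrightarrow> (incident x y \<longleftrightarrow> incident a b))"
  | "hyp_iso_rule E1 E2 (Inr x) (Inl y) (Inr a) (Inl b) \<longleftrightarrow>
      opposite x a \<and> opposite y b"
  | "hyp_iso_rule E1 E2 (Inr x) (Inr y) (Inr a) (Inr b) \<longleftrightarrow>
      opposite x a \<and> opposite y b \<and>
      edge_relation (left_of x a) (left_of y b) = edge_relation (right_of x a) (right_of y b)"
  | "hyp_iso_rule E1 E2 _ _ _ _ \<longleftrightarrow> False"

definition HypIso :: "'v set \<Rightarrow> 'v set set \<Rightarrow> 'w set \<Rightarrow> 'w set set \<Rightarrow>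
    (('v, 'w) hyp_question, ('v, 'w) hyp_question) sync_game"
  where "HypIso V1 E1 V2 E2 =
    (let Z = (V1 <+> V2) <+> (E1 <+> E2) in
      \<lparr>Questions_A = Z, Questions_B = Z, Answers_A = Z, Answers_B = Z,
       wins = hyp_iso_rule E1 E2\<rparr>)"

definition Iso :: "'v set \<Rightarrow> 'v set set \<Rightarrow> 'w set \<Rightarrow> 'w set set \<Rightarrow>
    ('v + 'w, 'v + 'w) sync_game"
  where "Iso V1 E1 V2 E2 =
    (let Z = V1 <+> V2 in
      \<lparr>Questions_A = Z, Questions_B = Z, Answers_A = Z, Answers_B = Z,
       wins = (\<lambda>x y a b.
         opposite x a \<and> opposite y b \<and>
         adjacency_relation E1 (left_of x a) (left_of y b) =
           adjacency_relation E2 (right_of x a) (right_of y b))\<rparr>)"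

end

theory Submission
  imports Defs
begin

text \<open>
  A question about vertices in \<open>HypIso G\<^sub>1 G\<^sub>2\<close> can only be answered successfully by vertices, and
  since hyperedges of a graph have exactly two elements, two distinct vertices lie in a common
  hyperedge iff they are adjacent. Hence, on vertices, \<^const>\<open>HypIso\<close> has the same winning
  condition as \<^const>\<open>Iso\<close>, and the players of \<^const>\<open>Iso\<close> can use a strategy for \<^const>\<open>HypIso\<close>.
  The only difficulty is that this strategy may formally answer with hyperedges; such answers
  do not occur in the correlation, but the corresponding operators need not vanish. They are
  therefore \<^emph>\<open>merged\<close> into a fixed vertex answer, which keeps all normalisations exact.

  In general, let \<open>g\<close> send the questions of a game \<open>H\<close> to questions of \<open>G\<close>, let \<open>f\<close> send the answers
  of \<open>G\<close> to answers of \<open>H\<close>, and suppose that every winning combination \<open>(g x, g y, a, b)\<close> of \<open>G\<close>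
  gives a winning combination \<open>(x, y, f a, f b)\<close> of \<open>H\<close>. Then a strategy for \<open>G\<close> yields one for \<open>H\<close>:
  ask \<open>g x\<close> and relabel the answer by \<open>f\<close>. This is made precise for all types of strategies
  by summing over the fibres of \<open>f\<close>.

  \<^item> For correlations, one sums probabilities, positive matrices or positive operators
    (\<open>relabel_C_loc\<close>, \<open>relabel_C_q\<close>, \<open>relabel_C_qc\<close>). The resulting map on correlations
    is continuous, so it also preserves the closure (\<open>relabel_C_qa\<close>).
  \<^item> For algebras, sending the generator \<open>e\<^sub>x\<^sub>,\<^sub>a\<close> of the algebra of \<open>H\<close> to the sum of the generators
    \<open>e\<^bsub>g x,a'\<^esub>\<close> with \<open>f a' = a\<close> respects the relations (\<open>Phi_game_ideal\<close>) and hence induces a unital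
    *-homomorphism from the algebra of \<open>H\<close> to that of \<open>G\<close>. Such a homomorphism shows that the first
    algebra is non-zero when the second one is, and representations can be composed with it.
    That a sum of projections is again a projection needs the generators \<open>e\<^bsub>g x,a'\<^esub>\<close> of one question
    to be pairwise orthogonal, which holds because \<open>G\<close> rejects distinct answers to equal questions.
\<close>

section \<open>Fibres of answer maps\<close>

definition fibre :: "('a \<Rightarrow> 'c) \<Rightarrow> 'a set \<Rightarrow> 'c \<Rightarrow> 'a set"
  where "fibre f A c = {a \<in> A. f a = c}"

lemma finite_fibre [simp]: "finite A \<Longrightarrow> finite (fibre f A c)"
  by (simp add: fibre_def)

lemma sum_fibres:
  assumes "finite A" and "finite C" and "f ` A \<subseteq> C"
  shows "(\<Sum>c\<in>C. \<Sum>a\<in>fibre f A c. h a) = (\<Sum>a\<in>A. h a)"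
  unfolding fibre_def by (rule sum.group[OF assms])

section \<open>Relabelling correlations\<close>

text \<open>
  The first two parameters are the answer sets of the given correlation. The correlation is pulled
  back along the question maps \<open>g\<close> and \<open>h\<close> and pushed forward along the answer maps \<open>f\<close> and \<open>k\<close>.
\<close>

definition relabel_correlation ::
  "'a set \<Rightarrow> 'b set \<Rightarrow> ('x2 \<Rightarrow> 'x) \<Rightarrow> ('y2 \<Rightarrow> 'y) \<Rightarrow> ('a \<Rightarrow> 'a2) \<Rightarrow> ('b \<Rightarrow> 'b2) \<Rightarrow>
    ('x, 'y, 'a, 'b) correlation \<Rightarrow> ('x2, 'y2, 'a2, 'b2) correlation"
  where "relabel_correlation A B g h f k p =
    (\<lambda>x y a b. \<Sum>a'\<in>fibre f A a. \<Sum>b'\<in>fibre k B b. p (g x) (h y) a' b')"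

lemma conditional_distribution_relabel:
  assumes "finite A" "finite A2" "g ` X2 \<subseteq> X" "f ` A \<subseteq> A2"
    and q: "conditional_distribution X A q"
  shows "conditional_distribution X2 A2 (\<lambda>x a. \<Sum>a'\<in>fibre f A a. q (g x) a')"
  unfolding conditional_distribution_def
proof (intro ballI conjI)
  fix x assume "x \<in> X2"
  then have x: "g x \<in> X"
    using assms by auto
  show "0 \<le> (\<Sum>a'\<in>fibre f A a. q (g x) a')" for a
    using q x by (intro sum_nonneg) (auto simp: conditional_distribution_def fibre_def)
  show "(\<Sum>a\<in>A2. \<Sum>a'\<in>fibre f A a. q (g x) a') = 1"
    using q x assms by (simp add: sum_fibres conditional_distribution_def)
qed

locale relabelling =
  fixes X :: "'x set" and Y :: "'y set" and A :: "'a set" and B :: "'b set"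
    and X2 :: "'x2 set" and Y2 :: "'y2 set" and A2 :: "'a2 set" and B2 :: "'b2 set"
    and g :: "'x2 \<Rightarrow> 'x" and h :: "'y2 \<Rightarrow> 'y" and f :: "'a \<Rightarrow> 'a2" and k :: "'b \<Rightarrow> 'b2"
  assumes finite_answers: "finite A" "finite B" "finite A2" "finite B2"
    and questions: "g ` X2 \<subseteq> X" "h ` Y2 \<subseteq> Y"
    and answers: "f ` A \<subseteq> A2" "k ` B \<subseteq> B2"
begin

abbreviation relabel :: "('x, 'y, 'a, 'b) correlation \<Rightarrow> ('x2, 'y2, 'a2, 'b2) correlation"
  where "relabel \<equiv> relabel_correlation A B g h f k"

lemma relabel_in_correlations:
  assumes p: "p \<in> correlations X Y A B"
  shows "relabel p \<in> correlations X2 Y2 A2 B2"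
proof -
  have "0 \<le> relabel p x y a b" if "x \<in> X2" "y \<in> Y2" for x y a b
    using p questions that
    unfolding relabel_correlation_def
    by (intro sum_nonneg) (auto simp: correlations_def fibre_def image_subset_iff)
  moreover have "(\<Sum>a\<in>A2. \<Sum>b\<in>B2. relabel p x y a b) = 1" if "x \<in> X2" "y \<in> Y2" for x y
  proof -
    have "(\<Sum>a\<in>A2. \<Sum>b\<in>B2. relabel p x y a b)
        = (\<Sum>a\<in>A2. \<Sum>a'\<in>fibre f A a. \<Sum>b\<in>B2. \<Sum>b'\<in>fibre k B b. p (g x) (h y) a' b')"
      unfolding relabel_correlation_def by (intro sum.cong refl sum.swap)
    also have "\<dots> = (\<Sum>a\<in>A. \<Sum>b\<in>B. p (g x) (h y) a b)"
      using finite_answers answers by (simp add: sum_fibres)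
    also have "\<dots> = 1"
      using p questions that by (auto simp: correlations_def image_subset_iff)
    finally show ?thesis .
  qed
  ultimately show ?thesis
    by (simp add: correlations_def)
qed

lemma relabel_C_loc:
  assumes p: "p \<in> C_loc X Y A B"
  shows "relabel p \<in> C_loc X2 Y2 A2 B2"
proof -
  from p obtain N :: nat and w p1 p2 where w: "\<forall>i<N. 0 \<le> w i" "(\<Sum>i<N. w i) = 1"
    and d: "\<forall>i<N. conditional_distribution X A (p1 i) \<and> conditional_distribution Y B (p2 i)"
    and eq: "\<forall>x\<in>X. \<forall>y\<in>Y. \<forall>a\<in>A. \<forall>b\<in>B. p x y a b = (\<Sum>i<N. w i * (p1 i x a * p2 i y b))"
    unfolding C_loc_def by blast
  define q1 where "q1 i x a = (\<Sum>a'\<in>fibre f A a. p1 i (g x) a')" for i x a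
  define q2 where "q2 i y b = (\<Sum>b'\<in>fibre k B b. p2 i (h y) b')" for i y b
  have "conditional_distribution X2 A2 (q1 i) \<and> conditional_distribution Y2 B2 (q2 i)"
    if "i < N" for i
    unfolding q1_def q2_def using that d finite_answers questions answers
    by (intro conjI conditional_distribution_relabel[where X = X and A = A]
        conditional_distribution_relabel[where X = Y and A = B]) auto
  moreover have "relabel p x y a b = (\<Sum>i<N. w i * (q1 i x a * q2 i y b))"
    if "x \<in> X2" "y \<in> Y2" for x y a b
  proof -
    have "relabel p x y a b = (\<Sum>a'\<in>fibre f A a. \<Sum>b'\<in>fibre k B b.
        \<Sum>i<N. w i * (p1 i (g x) a' * p2 i (h y) b'))"
      unfolding relabel_correlation_def using eq that questions
      by (intro sum.cong refl) (auto simp: fibre_def image_subset_iff)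
    also have "\<dots> = (\<Sum>i<N. \<Sum>a'\<in>fibre f A a. \<Sum>b'\<in>fibre k B b.
        w i * (p1 i (g x) a' * p2 i (h y) b'))"
      by (simp only: sum.swap[of _ "{..<N}"])
    also have "\<dots> = (\<Sum>i<N. w i * (q1 i x a * q2 i y b))"
      by (simp only: q1_def q2_def sum_product) (simp only: sum_distrib_left)
    finally show ?thesis .
  qed
  moreover have "relabel p \<in> correlations X2 Y2 A2 B2"
    using p relabel_in_correlations by (simp add: C_loc_def)
  ultimately show ?thesis
    unfolding C_loc_def mem_Collect_eq using w
    by (intro conjI exI[of _ N] exI[of _ w] exI[of _ q1] exI[of _ q2]) simp_all
qed

end

subsection \<open>Quantum strategies\<close>

text \<open>
  The size is a parameter because an empty sum of matrices would otherwise have no dimensions;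
  empty sums occur when a fibre is empty.
\<close>

definition sum_mat :: "nat \<Rightarrow> ('a \<Rightarrow> complex mat) \<Rightarrow> 'a set \<Rightarrow> complex mat"
  where "sum_mat n M S = Matrix.mat n n (\<lambda>(i, j). \<Sum>a\<in>S. M a $$ (i, j))"

lemma quadratic_form_expand:
  fixes M :: "complex mat"
  assumes "M \<in> carrier_mat n n" and "v \<in> carrier_vec n"
  shows "(M *\<^sub>v v) \<bullet>c v = (\<Sum>i<n. \<Sum>j<n. M $$ (i, j) * v $ j * cnj (v $ i))"
  using assms
  by (auto simp: scalar_prod_def sum_distrib_right lessThan_atLeast0 intro!: sum.cong)

lemma quadratic_form_sum:
  fixes N :: "'a \<Rightarrow> complex mat"
  assumes M: "M \<in> carrier_mat n n" and N: "\<And>a. a \<in> S \<Longrightarrow> N a \<in> carrier_mat n n"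
    and v: "v \<in> carrier_vec n"
    and entries: "\<And>i j. i < n \<Longrightarrow> j < n \<Longrightarrow> M $$ (i, j) = (\<Sum>a\<in>S. N a $$ (i, j))"
  shows "(M *\<^sub>v v) \<bullet>c v = (\<Sum>a\<in>S. (N a *\<^sub>v v) \<bullet>c v)"
proof -
  have "(M *\<^sub>v v) \<bullet>c v = (\<Sum>i<n. \<Sum>j<n. \<Sum>a\<in>S. N a $$ (i, j) * v $ j * cnj (v $ i))"
    by (simp add: quadratic_form_expand[OF M v] entries sum_distrib_right)
  also have "\<dots> = (\<Sum>a\<in>S. \<Sum>i<n. \<Sum>j<n. N a $$ (i, j) * v $ j * cnj (v $ i))"
    by (simp only: sum.swap[of _ _ S])
  also have "\<dots> = (\<Sum>a\<in>S. (N a *\<^sub>v v) \<bullet>c v)"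
    by (simp add: quadratic_form_expand[OF N v])
  finally show ?thesis .
qed

lemma positive_sum_mat:
  assumes "\<And>a. a \<in> S \<Longrightarrow> positive_matrix n (M a)"
  shows "positive_matrix n (sum_mat n M S)"
  unfolding positive_matrix_def
proof (intro conjI ballI)
  show "sum_mat n M S \<in> carrier_mat n n"
    by (simp add: sum_mat_def)
  fix v :: "complex Matrix.vec" assume v: "v \<in> carrier_vec n"
  have "(sum_mat n M S *\<^sub>v v) \<bullet>c v = (\<Sum>a\<in>S. (M a *\<^sub>v v) \<bullet>c v)"
    using assms v by (intro quadratic_form_sum) (auto simp: sum_mat_def positive_matrix_def)
  also have "0 \<le> \<dots>"
    using assms v by (intro sum_nonneg) (auto simp: positive_matrix_def)
  finally show "0 \<le> (sum_mat n M S *\<^sub>v v) \<bullet>c v" .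
qed

lemma povm_matrix_relabel:
  assumes "finite A" "finite A2" "f ` A \<subseteq> A2" and E: "povm_matrix n A E"
  shows "povm_matrix n A2 (\<lambda>a. sum_mat n E (fibre f A a))"
proof -
  have "(\<Sum>a\<in>A2. sum_mat n E (fibre f A a) $$ (i, j)) = (\<Sum>a\<in>A. E a $$ (i, j))"
    if "i < n" "j < n" for i j
    using that assms(1-3) by (simp add: sum_mat_def sum_fibres)
  then have "Matrix.mat n n (\<lambda>(i, j). \<Sum>a\<in>A2. sum_mat n E (fibre f A a) $$ (i, j)) =
      Matrix.mat n n (\<lambda>(i, j). \<Sum>a\<in>A. E a $$ (i, j))"
    by (intro eq_matI) auto
  then show ?thesis
    using E by (auto simp: povm_matrix_def fibre_def intro!: positive_sum_mat)
qed

lemma tensor_mat_carrier: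
  "S \<in> carrier_mat m m \<Longrightarrow> T \<in> carrier_mat n n \<Longrightarrow> tensor_mat S T \<in> carrier_mat (m * n) (m * n)"
  by (simp add: tensor_mat_def)

lemma tensor_mat_entry:
  assumes "S \<in> carrier_mat m m" and "T \<in> carrier_mat n n" and "i < m * n" and "j < m * n"
  shows "tensor_mat S T $$ (i, j) = S $$ (i div n, j div n) * T $$ (i mod n, j mod n)"
  using assms by (simp add: tensor_mat_def)

text \<open>
  The operator \<open>(P \<otimes> I)(I \<otimes> Q)\<close> is bilinear in \<open>P\<close> and \<open>Q\<close>, as one sees from its entries, and
  a quadratic form is linear in the operator. This is what makes the correlation of the summed
  measurements the sum of the correlations.
\<close>

lemma local_product_sum_mat:
  fixes E :: "'a \<Rightarrow> complex mat" and F :: "'b \<Rightarrow> complex mat"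
  defines "M \<equiv> \<lambda>m n P Q. tensor_mat P (1\<^sub>m n) * tensor_mat (1\<^sub>m m) Q"
  assumes E: "\<And>a. a \<in> S \<Longrightarrow> E a \<in> carrier_mat m m" and F: "\<And>b. b \<in> T \<Longrightarrow> F b \<in> carrier_mat n n"
    and v: "v \<in> carrier_vec (m * n)"
  shows "(M m n (sum_mat m E S) (sum_mat n F T) *\<^sub>v v) \<bullet>c v
    = (\<Sum>a\<in>S. \<Sum>b\<in>T. (M m n (E a) (F b) *\<^sub>v v) \<bullet>c v)"
proof -
  have entry: "M m n P Q $$ (i, j) = (\<Sum>l<m * n. (P $$ (i div n, l div n) * 1\<^sub>m n $$ (i mod n, l mod n)) *
      (1\<^sub>m m $$ (l div n, j div n) * Q $$ (l mod n, j mod n)))"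
    if "P \<in> carrier_mat m m" "Q \<in> carrier_mat n n" "i < m * n" "j < m * n" for P Q i j
  proof -
    have "M m n P Q $$ (i, j)
        = (\<Sum>l<m * n. tensor_mat P (1\<^sub>m n) $$ (i, l) * tensor_mat (1\<^sub>m m) Q $$ (l, j))"
      using that tensor_mat_carrier[of P m "1\<^sub>m n" n] tensor_mat_carrier[of "1\<^sub>m m" m Q n]
      by (auto simp: M_def scalar_prod_def lessThan_atLeast0 intro!: sum.cong)
    then show ?thesis
      using that by (simp add: tensor_mat_entry[of _ m _ n])
  qed
  have car: "M m n P Q \<in> carrier_mat (m * n) (m * n)"
    if "P \<in> carrier_mat m m" "Q \<in> carrier_mat n n" for P Q
    unfolding M_def using that
    by (intro mult_carrier_mat[where n = "m * n"] tensor_mat_carrier) auto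
  have bilinear: "M m n (sum_mat m E S) (sum_mat n F T) $$ (i, j)
      = (\<Sum>(a, b)\<in>S \<times> T. M m n (E a) (F b) $$ (i, j))"
    if ij: "i < m * n" "j < m * n" for i j
  proof -
    have n: "l div n < m" "l mod n < n" if "l < m * n" for l
      using that by (simp add: less_mult_imp_div_less, cases "n = 0") simp_all
    let ?e = "\<lambda>a l. E a $$ (i div n, l div n) * 1\<^sub>m n $$ (i mod n, l mod n)"
    let ?f = "\<lambda>b l. 1\<^sub>m m $$ (l div n, j div n) * F b $$ (l mod n, j mod n)"
    have "M m n (sum_mat m E S) (sum_mat n F T) $$ (i, j)
        = (\<Sum>l<m * n. (\<Sum>a\<in>S. ?e a l) * (\<Sum>b\<in>T. ?f b l))"
      using ij n by (subst entry) (simp_all add: sum_mat_def sum_distrib_left sum_distrib_right)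
    also have "\<dots> = (\<Sum>l<m * n. \<Sum>a\<in>S. \<Sum>b\<in>T. ?e a l * ?f b l)"
      by (simp add: sum_product)
    also have "\<dots> = (\<Sum>a\<in>S. \<Sum>b\<in>T. \<Sum>l<m * n. ?e a l * ?f b l)"
      by (simp only: sum.swap[of _ _ "{..<m * n}"])
    also have "\<dots> = (\<Sum>a\<in>S. \<Sum>b\<in>T. M m n (E a) (F b) $$ (i, j))"
      using ij E F by (intro sum.cong refl) (simp add: entry)
    finally show ?thesis
      by (simp add: sum.cartesian_product)
  qed
  have "(M m n (sum_mat m E S) (sum_mat n F T) *\<^sub>v v) \<bullet>c v
      = (\<Sum>ab\<in>S \<times> T. (M m n (E (fst ab)) (F (snd ab)) *\<^sub>v v) \<bullet>c v)"
    using E F v bilinear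
    by (intro quadratic_form_sum[where n = "m * n"] car) (auto simp: sum_mat_def case_prod_unfold)
  then show ?thesis
    by (simp add: sum.cartesian_product case_prod_unfold)
qed

context relabelling
begin

lemma relabel_C_q:
  assumes p: "p \<in> C_q X Y A B"
  shows "relabel p \<in> C_q X2 Y2 A2 B2"
proof -
  from p obtain m n and \<xi> :: "complex Matrix.vec" and E F
    where \<xi>: "\<xi> \<in> carrier_vec (m * n)" "\<xi> \<bullet>c \<xi> = 1"
      and E: "\<forall>x\<in>X. povm_matrix m A (E x)" and F: "\<forall>y\<in>Y. povm_matrix n B (F y)"
      and eq: "\<forall>x\<in>X. \<forall>y\<in>Y. \<forall>a\<in>A. \<forall>b\<in>B. complex_of_real (p x y a b) =
        ((tensor_mat (E x a) (1\<^sub>m n) * tensor_mat (1\<^sub>m m) (F y b)) *\<^sub>v \<xi>) \<bullet>c \<xi>"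
    unfolding C_q_def by blast
  define E2 where "E2 x a = sum_mat m (E (g x)) (fibre f A a)" for x a
  define F2 where "F2 y b = sum_mat n (F (h y)) (fibre k B b)" for y b
  have "povm_matrix m A2 (E2 x)" if "x \<in> X2" for x
    unfolding E2_def using that E questions answers finite_answers
    by (intro povm_matrix_relabel) auto
  moreover have "povm_matrix n B2 (F2 y)" if "y \<in> Y2" for y
    unfolding F2_def using that F questions answers finite_answers
    by (intro povm_matrix_relabel) auto
  moreover have "complex_of_real (relabel p x y a b) =
      ((tensor_mat (E2 x a) (1\<^sub>m n) * tensor_mat (1\<^sub>m m) (F2 y b)) *\<^sub>v \<xi>) \<bullet>c \<xi>"
    if xy: "x \<in> X2" "y \<in> Y2" for x y a b
  proof -
    have gh: "g x \<in> X" "h y \<in> Y"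
      using xy questions by auto
    have "complex_of_real (relabel p x y a b) = (\<Sum>a'\<in>fibre f A a. \<Sum>b'\<in>fibre k B b.
        ((tensor_mat (E (g x) a') (1\<^sub>m n) * tensor_mat (1\<^sub>m m) (F (h y) b')) *\<^sub>v \<xi>) \<bullet>c \<xi>)"
      unfolding relabel_correlation_def of_real_sum
      using gh eq by (intro sum.cong refl) (auto simp: fibre_def)
    also have "\<dots> = ((tensor_mat (E2 x a) (1\<^sub>m n) * tensor_mat (1\<^sub>m m) (F2 y b)) *\<^sub>v \<xi>) \<bullet>c \<xi>"
      unfolding E2_def F2_def using gh E F \<xi>(1)
      by (intro local_product_sum_mat[symmetric])
        (auto simp: povm_matrix_def positive_matrix_def fibre_def)
    finally show ?thesis .
  qed
  moreover have "relabel p \<in> correlations X2 Y2 A2 B2"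
    using p relabel_in_correlations by (simp add: C_q_def)
  ultimately show ?thesis
    unfolding C_q_def mem_Collect_eq using \<xi>
    by (intro conjI exI[of _ m] exI[of _ n] exI[of _ \<xi>] exI[of _ E2] exI[of _ F2]) simp_all
qed

text \<open>
  Every coordinate of the relabelled correlation is a finite sum of coordinates, so relabelling is
  continuous for pointwise convergence, and approximations by quantum correlations are
  carried along.
\<close>

lemma continuous_relabel: "continuous_on UNIV relabel"
proof (intro continuous_on_coordinatewise_then_product)
  fix x y a b
  have "continuous_on UNIV (\<lambda>p :: ('x, 'y, 'a, 'b) correlation. p (g x) (h y) a' b')" for a' b'
    by (rule continuous_on_product_coordinates[THEN continuous_on_product_then_coordinatewise,
          THEN continuous_on_product_then_coordinatewise,
          THEN continuous_on_product_then_coordinatewise])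
  then show "continuous_on UNIV (\<lambda>p. relabel p x y a b)"
    unfolding relabel_correlation_def by (intro continuous_on_sum)
qed

lemma relabel_C_qa:
  assumes p: "p \<in> C_qa X Y A B"
  shows "relabel p \<in> C_qa X2 Y2 A2 B2"
proof -
  have "relabel ` closure (C_q X Y A B) \<subseteq> closure (C_q X2 Y2 A2 B2)"
    using relabel_C_q closure_subset
    by (intro image_closure_subset continuous_on_subset[OF continuous_relabel]) auto
  then show ?thesis
    using p by (auto simp: C_qa_def)
qed

end

subsection \<open>Quantum commuting strategies\<close>

lemma bounded_clinear_sum:
  assumes "\<And>a. a \<in> S \<Longrightarrow> bounded_clinear (E a)"
  shows "bounded_clinear (\<lambda>v. \<Sum>a\<in>S. E a v)"
proof -
  have add0: "scaleC c (0::'b::complex_hilbert_space) = 0" for c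
    using scaleC_add_right[of c 0 0] by simp
  have "(\<Sum>a\<in>S. E a (scaleC c v)) = scaleC c (\<Sum>a\<in>S. E a v)" for c v
    using assms
    by (induction S rule: infinite_finite_induct)
      (auto simp: add0 scaleC_add_right bounded_clinear_def)
  then show ?thesis
    using assms by (auto simp: bounded_clinear_def intro!: bounded_linear_sum)
qed

lemma cinner_sum_left: "cinner (\<Sum>a\<in>S. u a) v = (\<Sum>a\<in>S. cinner (u a) v)"
proof -
  have "cinner (0::'a) v = 0"
    using cinner_add_left[of 0 0 v] by simp
  then show ?thesis
    by (induction S rule: infinite_finite_induct) (auto simp: cinner_add_left)
qed

lemma povm_relabel:
  assumes "finite A" "finite A2" "f ` A \<subseteq> A2" and E: "povm A E"
  shows "povm A2 (\<lambda>a v. \<Sum>a'\<in>fibre f A a. E a' v)"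
proof -
  have "positive_operator (\<lambda>v. \<Sum>a'\<in>fibre f A a. E a' v)" for a
    using E
    by (auto simp: povm_def positive_operator_def cinner_sum_left fibre_def
        intro!: bounded_clinear_sum sum_nonneg)
  then show ?thesis
    using E assms(1-3) by (simp add: povm_def sum_fibres)
qed

context relabelling
begin

text \<open>
  The Hilbert space and the vector are kept; sums of operators from two commuting families commute.
\<close>

lemma relabel_C_qc:
  assumes p: "p \<in> C_qc TYPE('h::complex_hilbert_space) X Y A B"
  shows "relabel p \<in> C_qc TYPE('h) X2 Y2 A2 B2"
proof -
  from p obtain \<xi> :: 'h and E F where \<xi>: "norm \<xi> = 1"
    and E: "\<forall>x\<in>X. povm A (E x)" and F: "\<forall>y\<in>Y. povm B (F y)"
    and comm: "\<forall>x\<in>X. \<forall>y\<in>Y. \<forall>a\<in>A. \<forall>b\<in>B. E x a \<circ> F y b = F y b \<circ> E x a"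
    and eq: "\<forall>x\<in>X. \<forall>y\<in>Y. \<forall>a\<in>A. \<forall>b\<in>B.
        complex_of_real (p x y a b) = cinner (E x a (F y b \<xi>)) \<xi>"
    unfolding C_qc_def mem_Collect_eq by (elim conjE exE) (rule that)
  define E2 where "E2 x a v = (\<Sum>a'\<in>fibre f A a. E (g x) a' v)" for x a v
  define F2 where "F2 y b v = (\<Sum>b'\<in>fibre k B b. F (h y) b' v)" for y b v
  have linE: "linear (E x a)" if "x \<in> X" "a \<in> A" for x a
    using that E
    by (simp add: povm_def positive_operator_def bounded_clinear_def bounded_linear.linear)
  have linF: "linear (F y b)" if "y \<in> Y" "b \<in> B" for y b
    using that F
    by (simp add: povm_def positive_operator_def bounded_clinear_def bounded_linear.linear)
  have EF: "E2 x a (F2 y b v)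
      = (\<Sum>a'\<in>fibre f A a. \<Sum>b'\<in>fibre k B b. E (g x) a' (F (h y) b' v))"
    if "x \<in> X2" "y \<in> Y2" for x y a b v
    unfolding E2_def F2_def
    using that questions linE
    by (intro sum.cong refl linear_sum) (auto simp: fibre_def image_subset_iff)
  have FE: "F2 y b (E2 x a v)
      = (\<Sum>b'\<in>fibre k B b. \<Sum>a'\<in>fibre f A a. F (h y) b' (E (g x) a' v))"
    if "x \<in> X2" "y \<in> Y2" for x y a b v
    unfolding E2_def F2_def
    using that questions linF
    by (intro sum.cong refl linear_sum) (auto simp: fibre_def image_subset_iff)
  have "povm A2 (E2 x)" if "x \<in> X2" for x
    unfolding E2_def using that E questions answers finite_answers
    by (intro povm_relabel) auto
  moreover have "povm B2 (F2 y)" if "y \<in> Y2" for y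
    unfolding F2_def using that F questions answers finite_answers
    by (intro povm_relabel) auto
  moreover have "E2 x a \<circ> F2 y b = F2 y b \<circ> E2 x a" if xy: "x \<in> X2" "y \<in> Y2" for x y a b
  proof
    fix v
    have "E (g x) a' (F (h y) b' v) = F (h y) b' (E (g x) a' v)" if "a' \<in> A" "b' \<in> B" for a' b'
      using comm xy that questions unfolding fun_eq_iff by (auto simp: image_subset_iff)
    then have "E2 x a (F2 y b v)
        = (\<Sum>a'\<in>fibre f A a. \<Sum>b'\<in>fibre k B b. F (h y) b' (E (g x) a' v))"
      unfolding EF[OF xy] by (intro sum.cong refl) (auto simp: fibre_def)
    also have "\<dots> = F2 y b (E2 x a v)"
      unfolding FE[OF xy] by (rule sum.swap)
    finally show "(E2 x a \<circ> F2 y b) v = (F2 y b \<circ> E2 x a) v"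
      by simp
  qed
  moreover have "complex_of_real (relabel p x y a b) = cinner (E2 x a (F2 y b \<xi>)) \<xi>"
    if xy: "x \<in> X2" "y \<in> Y2" for x y a b
    unfolding EF[OF xy] cinner_sum_left relabel_correlation_def of_real_sum
    using xy questions eq by (intro sum.cong refl) (auto simp: fibre_def image_subset_iff)
  moreover have "relabel p \<in> correlations X2 Y2 A2 B2"
    using p relabel_in_correlations by (simp add: C_qc_def)
  ultimately show ?thesis
    unfolding C_qc_def mem_Collect_eq using \<xi>
    by (intro conjI exI[of _ \<xi>] exI[of _ E2] exI[of _ F2]) simp_all
qed

end

section \<open>The free *-algebra\<close>

lemma free_elem_expand:
  "p = (\<Sum>w\<in>Poly_Mapping.keys p. Poly_Mapping.single w (Poly_Mapping.lookup p w))"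
  by (rule poly_mapping_eqI) (simp add: lookup_sum lookup_single when_def in_keys_iff)

text \<open>
  Identities between additive maps only have to be checked on scalar multiples of words.
\<close>

lemma free_elem_induct [case_names single add]:
  fixes p :: "'g free_elem"
  assumes single: "\<And>w c. P (Poly_Mapping.single w c)"
    and add: "\<And>p q. P p \<Longrightarrow> P q \<Longrightarrow> P (p + q)"
  shows "P p"
proof -
  have "P (\<Sum>w\<in>S. Poly_Mapping.single w (Poly_Mapping.lookup p w))" for S
  proof (induction S rule: infinite_finite_induct)
    case (insert w S)
    then show ?case
      using single add by simp
  qed (use single[of 0 0] in simp_all)
  then show ?thesis
    by (subst free_elem_expand)
qed

lemma free_star_add: "free_star (p + q) = free_star p + free_star q"
  unfolding free_star_def by (rule setsum_keys_plus_distrib) (simp_all add: single_add)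

lemma free_star_single:
  "free_star (Poly_Mapping.single w c) = Poly_Mapping.single (star_word w) (cnj c)"
  by (simp add: free_star_def)

lemma star_word_plus: "star_word (u + v) = star_word v + star_word u"
  by (cases u; cases v) simp

lemma star_word_star_word: "star_word (star_word w) = w"
proof -
  have "star_letter (star_letter l) = l" for l :: "'a letter"
    by (cases l) simp_all
  then show ?thesis
    by (cases w) (simp add: rev_map o_def)
qed

lemma free_star_zero: "free_star 0 = 0"
  by (simp add: free_star_def)

lemma free_star_sum: "free_star (\<Sum>a\<in>S. p a) = (\<Sum>a\<in>S. free_star (p a))"
  by (induction S rule: infinite_finite_induct) (simp_all add: free_star_add free_star_zero)

lemma free_star_free_star: "free_star (free_star p) = p"
  by (induction p rule: free_elem_induct)
    (simp_all add: free_star_add free_star_single star_word_star_word)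

lemma free_star_mult: "free_star (p * q) = free_star q * free_star p"
proof (induction p rule: free_elem_induct)
  case (single u c)
  show ?case
    by (induction q rule: free_elem_induct)
      (simp_all add: free_star_add free_star_single mult_single star_word_plus mult.commute
        algebra_simps)
qed (simp add: free_star_add algebra_simps)

lemma free_star_scalar: "free_star (scalar c) = scalar (cnj c)"
  by (simp add: scalar_def free_star_single zero_word_def)

lemma scalar_one: "scalar 1 = 1"
  by (simp add: scalar_def)

lemma scalar_add: "scalar (c + d) = scalar c + scalar d"
  by (simp add: scalar_def single_add)

lemma scalar_mult: "scalar (c * d) = scalar c * scalar d"
  by (simp add: scalar_def mult_single)

lemma scalar_commute: "scalar c * p = p * scalar c"
  by (induction p rule: free_elem_induct)
    (simp_all add: scalar_def mult_single mult.commute distrib_left distrib_right)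

section \<open>Homomorphisms of free *-algebras\<close>

fun letter_value :: "('g \<Rightarrow> 'k free_elem) \<Rightarrow> 'g letter \<Rightarrow> 'k free_elem"
  where
    "letter_value \<sigma> (Gen s) = \<sigma> s"
  | "letter_value \<sigma> (Star s) = free_star (\<sigma> s)"

fun word_value :: "('g \<Rightarrow> 'k free_elem) \<Rightarrow> 'g word \<Rightarrow> 'k free_elem"
  where "word_value \<sigma> (Word u) = prod_list (map (letter_value \<sigma>) u)"

text \<open>
  The unital *-homomorphism that is determined by the images \<open>\<sigma>\<close> of the generators.
\<close>

definition free_hom :: "('g \<Rightarrow> 'k free_elem) \<Rightarrow> 'g free_elem \<Rightarrow> 'k free_elem"
  where "free_hom \<sigma> p =
    (\<Sum>w\<in>Poly_Mapping.keys p. scalar (Poly_Mapping.lookup p w) * word_value \<sigma> w)"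

lemma word_value_plus: "word_value \<sigma> (u + v) = word_value \<sigma> u * word_value \<sigma> v"
  by (cases u; cases v) simp

lemma word_value_star: "word_value \<sigma> (star_word w) = free_star (word_value \<sigma> w)"
proof -
  have letter: "letter_value \<sigma> (star_letter l) = free_star (letter_value \<sigma> l)" for l
    by (cases l) (simp_all add: free_star_free_star)
  have "prod_list (map (letter_value \<sigma>) (rev (map star_letter u)))
      = free_star (prod_list (map (letter_value \<sigma>) u))" for u
    by (induction u)
      (simp_all add: letter free_star_mult free_star_scalar[of 1, unfolded scalar_one, simplified]
        scalar_one)
  then show ?thesis
    by (cases w) (simp del: map_map)
qed

lemma free_hom_add: "free_hom \<sigma> (p + q) = free_hom \<sigma> p + free_hom \<sigma> q"
  unfolding free_hom_def
  by (rule setsum_keys_plus_distrib) (simp_all add: scalar_add distrib_right, simp add: scalar_def)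

lemma free_hom_single: "free_hom \<sigma> (Poly_Mapping.single w c) = scalar c * word_value \<sigma> w"
  by (simp add: free_hom_def) (simp add: scalar_def)

lemma free_hom_scalar: "free_hom \<sigma> (scalar c) = scalar c"
  by (simp add: scalar_def[of c] free_hom_single) (simp add: zero_word_def)

lemma free_hom_one: "free_hom \<sigma> 1 = 1"
  using free_hom_scalar[of \<sigma> 1] by (simp add: scalar_one)

lemma free_hom_zero: "free_hom \<sigma> 0 = 0"
  by (simp add: free_hom_def)

lemma free_hom_sum: "free_hom \<sigma> (\<Sum>a\<in>S. p a) = (\<Sum>a\<in>S. free_hom \<sigma> (p a))"
  by (induction S rule: infinite_finite_induct) (simp_all add: free_hom_add free_hom_zero)

lemma free_hom_diff: "free_hom \<sigma> (p - q) = free_hom \<sigma> p - free_hom \<sigma> q"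
  using free_hom_add[of \<sigma> "p - q" q] by simp

text \<open>
  On words this is concatenation; the coefficients can be collected because scalars are central.
\<close>

lemma free_hom_mult: "free_hom \<sigma> (p * q) = free_hom \<sigma> p * free_hom \<sigma> q"
proof (induction p rule: free_elem_induct)
  case (single u c)
  show ?case
  proof (induction q rule: free_elem_induct)
    case (single v d)
    have "scalar (c * d) * (word_value \<sigma> u * word_value \<sigma> v)
        = scalar c * (scalar d * word_value \<sigma> u) * word_value \<sigma> v"
      by (simp add: scalar_mult mult.assoc)
    also have "\<dots> = (scalar c * word_value \<sigma> u) * (scalar d * word_value \<sigma> v)"
      by (simp add: scalar_commute[of d "word_value \<sigma> u"] mult.assoc)
    finally show ?case
      by (simp add: mult_single free_hom_single word_value_plus)
  qed (simp add: free_hom_add distrib_left)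
qed (simp add: free_hom_add distrib_right)

lemma free_hom_star: "free_hom \<sigma> (free_star p) = free_star (free_hom \<sigma> p)"
  by (induction p rule: free_elem_induct)
    (simp_all add: free_star_add free_hom_add free_star_single free_hom_single word_value_star
      free_star_mult free_star_scalar scalar_commute)

lemma free_hom_gen: "free_hom \<sigma> (gen x a) = \<sigma> (x, a)"
  by (simp add: gen_def free_hom_single scalar_one)

subsection \<open>The free *-algebra on a subset of the generators\<close>

abbreviation free_carrier :: "'g set \<Rightarrow> 'g free_elem set"
  where "free_carrier S \<equiv> carrier (free_star_algebra S)"

lemma free_carrier_iff:
  "p \<in> free_carrier S \<longleftrightarrow> (\<forall>w\<in>Poly_Mapping.keys p. set_word w \<subseteq> S)"
  by (simp add: free_star_algebra_def)

lemma free_star_algebra_simps [simp]: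
  "monoid.mult (free_star_algebra S) = (*)" "one (free_star_algebra S) = 1"
  "zero (free_star_algebra S) = 0" "add (free_star_algebra S) = (+)"
  by (simp_all add: free_star_algebra_def)

lemma set_word_plus: "set_word (u + v) = set_word u \<union> set_word v"
  by (cases u; cases v) simp

lemma set_word_star: "set_word (star_word w) = set_word w"
proof -
  have "set_letter (star_letter l) = set_letter l" for l :: "'a letter"
    by (cases l) simp_all
  then show ?thesis
    by (cases w) simp
qed

lemma single_in_free_carrier:
  "set_word w \<subseteq> S \<Longrightarrow> Poly_Mapping.single w c \<in> free_carrier S"
  by (simp add: free_carrier_iff)

lemma scalar_in_free_carrier: "scalar c \<in> free_carrier S"
  by (simp add: scalar_def single_in_free_carrier zero_word_def)

lemma free_carrier_add:
  "p \<in> free_carrier S \<Longrightarrow> q \<in> free_carrier S \<Longrightarrow> p + q \<in> free_carrier S"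
  using Poly_Mapping.keys_add[of p q] unfolding free_carrier_iff by blast

lemma free_carrier_zero: "0 \<in> free_carrier S"
  by (simp add: free_carrier_iff)

lemma free_carrier_sum:
  "(\<And>a. a \<in> T \<Longrightarrow> p a \<in> free_carrier S) \<Longrightarrow> (\<Sum>a\<in>T. p a) \<in> free_carrier S"
  by (induction T rule: infinite_finite_induct) (simp_all add: free_carrier_add free_carrier_zero)

lemma free_carrier_mult:
  "p \<in> free_carrier S \<Longrightarrow> q \<in> free_carrier S \<Longrightarrow> p * q \<in> free_carrier S"
  using keys_mult[of p q] unfolding free_carrier_iff
  by (fastforce simp: set_word_plus)

lemma free_carrier_uminus: "p \<in> free_carrier S \<Longrightarrow> - p \<in> free_carrier S"
  by (simp add: free_carrier_iff in_keys_iff)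

lemma free_carrier_one: "1 \<in> free_carrier S"
  using scalar_in_free_carrier[of 1] by (simp add: scalar_one)

lemma free_carrier_diff:
  "p \<in> free_carrier S \<Longrightarrow> q \<in> free_carrier S \<Longrightarrow> p - q \<in> free_carrier S"
  using free_carrier_add[of p S "- q"] free_carrier_uminus[of q] by simp

lemma free_carrier_star: "p \<in> free_carrier S \<Longrightarrow> free_star p \<in> free_carrier S"
  unfolding free_star_def
  by (intro free_carrier_sum single_in_free_carrier) (simp add: set_word_star free_carrier_iff)

lemma gen_in_free_carrier: "(x, a) \<in> S \<Longrightarrow> gen x a \<in> free_carrier S"
  by (simp add: gen_def single_in_free_carrier)

lemma ring_free_star_algebra: "ring (free_star_algebra S)"
proof (intro ringI abelian_groupI monoidI)
  show "\<exists>q\<in>free_carrier S. q \<oplus>\<^bsub>free_star_algebra S\<^esub> p = \<zero>\<^bsub>free_star_algebra S\<^esub>"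
    if "p \<in> free_carrier S" for p
    using that free_carrier_uminus by (intro bexI[of _ "- p"]) simp_all
qed (simp_all add: free_carrier_add free_carrier_mult free_carrier_zero free_carrier_one
    algebra_simps)

lemma free_hom_in_free_carrier:
  assumes \<sigma>: "\<And>s. s \<in> S \<Longrightarrow> \<sigma> s \<in> free_carrier T" and p: "p \<in> free_carrier S"
  shows "free_hom \<sigma> p \<in> free_carrier T"
proof -
  have letter: "letter_value \<sigma> l \<in> free_carrier T" if "set_letter l \<subseteq> S" for l
    using that \<sigma> by (cases l) (simp_all add: free_carrier_star)
  have "prod_list (map (letter_value \<sigma>) u) \<in> free_carrier T" if "(\<Union>l\<in>set u. set_letter l) \<subseteq> S" for u
    using that by (induction u) (simp_all add: free_carrier_one free_carrier_mult letter)
  then have "word_value \<sigma> w \<in> free_carrier T" if "set_word w \<subseteq> S" for w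
    using that by (cases w) simp
  moreover have "set_word w \<subseteq> S" if "w \<in> Poly_Mapping.keys p" for w
    using p that by (simp add: free_carrier_iff)
  ultimately show ?thesis
    unfolding free_hom_def
    by (intro free_carrier_sum free_carrier_mult scalar_in_free_carrier) blast
qed

lemma free_hom_ring_hom:
  assumes "\<And>s. s \<in> S \<Longrightarrow> \<sigma> s \<in> free_carrier T"
  shows "ring_hom_ring (free_star_algebra S) (free_star_algebra T) (free_hom \<sigma>)"
  using assms
  by (intro ring_hom_ringI ring_free_star_algebra)
    (simp_all add: free_hom_in_free_carrier[of S] free_hom_mult free_hom_add free_hom_one)

section \<open>The algebra of a synchronous game\<close>

locale synchronous_game =
  fixes G :: "('x, 'a) sync_game"
  assumes same_questions: "Questions_B G = Questions_A G"
    and same_answers: "Answers_B G = Answers_A G"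
    and finite_answers: "finite (Answers_A G)"
begin

abbreviation "F \<equiv> game_free_algebra G"
abbreviation "I \<equiv> game_ideal G"

lemma ring_F: "ring F"
  unfolding game_free_algebra_def by (rule ring_free_star_algebra)

lemma F_simps [simp]:
  "monoid.mult F = (*)" "one F = 1" "zero F = 0" "add F = (+)"
  by (simp_all add: game_free_algebra_def)

lemma gen_in_F: "x \<in> Questions_A G \<Longrightarrow> a \<in> Answers_A G \<Longrightarrow> gen x a \<in> carrier F"
  unfolding game_free_algebra_def by (rule gen_in_free_carrier) simp

lemma game_relations_in_F: "game_relations G \<subseteq> carrier F"
  unfolding game_relations_def same_questions same_answers
  using gen_in_F unfolding game_free_algebra_def
  by (auto intro!: free_carrier_diff free_carrier_star free_carrier_mult free_carrier_sum
      free_carrier_one)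

lemma ideal_game_ideal: "ideal I F"
  unfolding game_ideal_def
proof (rule ring.i_Intersect[OF ring_F])
  have "free_star ` carrier F \<subseteq> carrier F"
    unfolding game_free_algebra_def by (auto intro: free_carrier_star)
  then show "{I. ideal I F \<and> free_star ` I \<subseteq> I \<and> game_relations G \<subseteq> I} \<noteq> {}"
    using ring.oneideal[OF ring_F] game_relations_in_F by blast
qed simp

lemma game_relations_in_ideal: "game_relations G \<subseteq> I"
  by (auto simp: game_ideal_def)

lemma gen_self_adjoint_in_ideal:
  "x \<in> Questions_A G \<Longrightarrow> a \<in> Answers_A G \<Longrightarrow> gen x a - free_star (gen x a) \<in> I"
  using game_relations_in_ideal unfolding game_relations_def by blast

lemma gen_idempotent_in_ideal:
  "x \<in> Questions_A G \<Longrightarrow> a \<in> Answers_A G \<Longrightarrow> gen x a - gen x a * gen x a \<in> I"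
  using game_relations_in_ideal unfolding game_relations_def by blast

lemma gen_complete_in_ideal:
  "x \<in> Questions_A G \<Longrightarrow> (\<Sum>a\<in>Answers_A G. gen x a) - 1 \<in> I"
  using game_relations_in_ideal unfolding game_relations_def by blast

lemma gen_orthogonal_in_ideal:
  assumes "x \<in> Questions_A G" "y \<in> Questions_A G" "a \<in> Answers_A G" "b \<in> Answers_A G"
    and "\<not> wins G x y a b"
  shows "gen x a * gen y b \<in> I"
  using assms game_relations_in_ideal
  unfolding game_relations_def same_questions same_answers by blast

lemma star_game_ideal: "p \<in> I \<Longrightarrow> free_star p \<in> I"
  by (auto simp: game_ideal_def)

lemma game_ideal_least:
  assumes "ideal J F" and "free_star ` J \<subseteq> J" and "game_relations G \<subseteq> J"
  shows "I \<subseteq> J"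
  using assms unfolding game_ideal_def by blast

lemma game_ideal_add: "p \<in> I \<Longrightarrow> q \<in> I \<Longrightarrow> p + q \<in> I"
  using additive_subgroup.a_closed[OF ideal.axioms(1)[OF ideal_game_ideal], of p q] by simp

lemma game_ideal_zero: "0 \<in> I"
  using additive_subgroup.zero_closed[OF ideal.axioms(1)[OF ideal_game_ideal]] by simp

lemma game_ideal_sum: "(\<And>s. s \<in> S \<Longrightarrow> p s \<in> I) \<Longrightarrow> (\<Sum>s\<in>S. p s) \<in> I"
  by (induction S rule: infinite_finite_induct) (simp_all add: game_ideal_add game_ideal_zero)

lemma game_ideal_diff:
  assumes "p \<in> I" and "q \<in> I"
  shows "p - q \<in> I"
proof -
  have "scalar (- 1) * q \<in> I"
    using ideal.I_l_closed[OF ideal_game_ideal assms(2), of "scalar (- 1)"]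
    by (simp add: game_free_algebra_def scalar_in_free_carrier)
  moreover have "scalar (- 1) * q = - q"
    by (simp add: scalar_def single_uminus)
  ultimately show ?thesis
    using game_ideal_add[OF assms(1), of "- q"] by simp
qed

text \<open>
  Elements of the quotient are handled through representatives: the following facts reduce
  every operation on cosets to the corresponding operation in the free algebra.
\<close>

definition coset :: "('x \<times> 'a) free_elem \<Rightarrow> ('x \<times> 'a) free_elem set"
  where "coset p = I +>\<^bsub>F\<^esub> p"

lemma coset_iff: "q \<in> coset p \<longleftrightarrow> (\<exists>r\<in>I. q = r + p)"
  by (auto simp: coset_def a_r_coset_def')

lemma coset_eqI:
  assumes "q - p \<in> I"
  shows "coset q = coset p"
proof (rule Set.set_eqI)
  fix z
  have "z - q \<in> I \<longleftrightarrow> z - p \<in> I"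
    using game_ideal_add[OF _ assms, of "z - q"] game_ideal_diff[OF _ assms, of "z - p"]
    by auto
  moreover have "z \<in> coset s \<longleftrightarrow> z - s \<in> I" for s
    unfolding coset_iff by (metis add_diff_cancel_right' diff_add_cancel)
  ultimately show "z \<in> coset q \<longleftrightarrow> z \<in> coset p"
    by simp
qed

lemma coset_eq_ideal_iff: "coset p = I \<longleftrightarrow> p \<in> I"
proof
  assume "coset p = I"
  then show "p \<in> I"
    using game_ideal_zero coset_iff[of p p] by force
next
  assume "p \<in> I"
  then have "coset p = coset 0"
    by (intro coset_eqI) simp
  also have "coset 0 = I"
    by (rule Set.set_eqI) (simp add: coset_iff)
  finally show "coset p = I" .
qed

lemma game_algebra_simps:
  "carrier (game_algebra G) = coset ` carrier F"
  "\<one>\<^bsub>game_algebra G\<^esub> = coset 1"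
  "\<zero>\<^bsub>game_algebra G\<^esub> = I"
  by (auto simp: game_algebra_def FactRing_def A_RCOSETS_def' coset_def)

lemma game_algebra_ops:
  assumes "p \<in> carrier F" and "q \<in> carrier F"
  shows "coset p \<oplus>\<^bsub>game_algebra G\<^esub> coset q = coset (p + q)"
    and "coset p \<otimes>\<^bsub>game_algebra G\<^esub> coset q = coset (p * q)"
  using assms ideal.rcoset_mult_add[OF ideal_game_ideal, of p q]
    ring_hom_add[OF ideal.rcos_ring_hom[OF ideal_game_ideal], of p q]
  by (simp_all add: game_algebra_def coset_def FactRing_def)

lemma star_coset: "free_star ` coset p = coset (free_star p)"
proof (intro equalityI subsetI)
  fix q assume "q \<in> free_star ` coset p"
  then show "q \<in> coset (free_star p)"
    using star_game_ideal by (auto simp: coset_iff free_star_add)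
next
  fix q assume "q \<in> coset (free_star p)"
  then obtain r where r: "r \<in> I" "q = r + free_star p"
    by (auto simp: coset_iff)
  then have "q = free_star (free_star r + p)"
    by (simp add: free_star_add free_star_free_star)
  moreover have "free_star r + p \<in> coset p"
    using r star_game_ideal by (auto simp: coset_iff)
  ultimately show "q \<in> free_star ` coset p"
    by blast
qed

lemma game_algebra_trivial_iff:
  "carrier (game_algebra G) = {\<zero>\<^bsub>game_algebra G\<^esub>} \<longleftrightarrow> 1 \<in> I"
proof
  assume "carrier (game_algebra G) = {\<zero>\<^bsub>game_algebra G\<^esub>}"
  moreover have "1 \<in> carrier F"
    by (simp add: game_free_algebra_def free_carrier_one)
  ultimately show "1 \<in> I"
    unfolding game_algebra_simps using coset_eq_ideal_iff by blast
next
  assume "1 \<in> I"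
  then have F: "carrier F = I"
    using ideal.one_imp_carrier[OF ideal_game_ideal] by simp
  have "coset ` I = (\<lambda>_. I) ` I"
    by (rule image_cong) (simp_all only: coset_eq_ideal_iff)
  also have "\<dots> = {I}"
    using game_ideal_zero by (rule image_constant)
  finally show "carrier (game_algebra G) = {\<zero>\<^bsub>game_algebra G\<^esub>}"
    by (simp only: game_algebra_simps F)
qed

end

text \<open>
  A representation of the quotient, expressed through representatives. In this form it
  can be composed with a homomorphism between free algebras.
\<close>

lemma unital_star_representation_iff:
  assumes "synchronous_game G"
  shows "unital_star_representation G \<pi> \<longleftrightarrow>
    (let F = carrier (game_free_algebra G); c = synchronous_game.coset G in
      (\<forall>p\<in>F. bounded_clinear (\<pi> (c p))) \<and>
      \<pi> (c 1) = id \<and>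
      (\<forall>p\<in>F. \<forall>q\<in>F. \<pi> (c (p + q)) = (\<lambda>\<xi>. \<pi> (c p) \<xi> + \<pi> (c q) \<xi>)) \<and>
      (\<forall>p\<in>F. \<forall>q\<in>F. \<pi> (c (p * q)) = \<pi> (c p) \<circ> \<pi> (c q)) \<and>
      (\<forall>z. \<forall>p\<in>F. \<pi> (c (scalar z * p)) = (\<lambda>\<xi>. scaleC z (\<pi> (c p) \<xi>))) \<and>
      (\<forall>p\<in>F. \<forall>\<xi> \<eta>. cinner (\<pi> (c (free_star p)) \<xi>) \<eta> = cinner \<xi> (\<pi> (c p) \<eta>)))"
proof -
  interpret synchronous_game G
    by fact
  have scalars: "scalar z \<in> carrier F" for z
    by (simp add: game_free_algebra_def scalar_in_free_carrier)
  show ?thesis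
    unfolding unital_star_representation_def Let_def game_algebra_simps ball_simps coset_def[symmetric]
    by (simp only: game_algebra_ops scalars star_coset simp_thms cong: ball_cong)
qed

section \<open>Relabelling games\<close>

text \<open>
  The condition on \<open>wins\<close> is used in its contrapositive form: whatever the target game forbids is
  expressed as a sum of terms each of which the source game forbids.
\<close>

locale game_relabelling = source: synchronous_game G + target: synchronous_game G2
  for G :: "('x, 'a) sync_game" and G2 :: "('x2, 'a2) sync_game" +
  fixes g :: "'x2 \<Rightarrow> 'x" and f :: "'a \<Rightarrow> 'a2"
  assumes questions: "g ` Questions_A G2 \<subseteq> Questions_A G"
    and answers: "f ` Answers_A G \<subseteq> Answers_A G2"
    and synchronous: "\<And>x a b. x \<in> Questions_A G \<Longrightarrow> a \<in> Answers_A G \<Longrightarrow> b \<in> Answers_A G \<Longrightarrow>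
      wins G x x a b \<Longrightarrow> a = b"
    and wins_relabel: "\<And>x y a b. x \<in> Questions_A G2 \<Longrightarrow> y \<in> Questions_A G2 \<Longrightarrow>
      a \<in> Answers_A G \<Longrightarrow> b \<in> Answers_A G \<Longrightarrow>
      wins G (g x) (g y) a b \<Longrightarrow> wins G2 x y (f a) (f b)"
begin

definition coarse_gen :: "'x2 \<times> 'a2 \<Rightarrow> ('x \<times> 'a) free_elem"
  where "coarse_gen = (\<lambda>(x, a). \<Sum>a'\<in>fibre f (Answers_A G) a. gen (g x) a')"

abbreviation Phi :: "('x2 \<times> 'a2) free_elem \<Rightarrow> ('x \<times> 'a) free_elem"
  where "Phi \<equiv> free_hom coarse_gen"

lemma Phi_ring_hom: "ring_hom_ring target.F source.F Phi"
  unfolding game_free_algebra_def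
  by (rule free_hom_ring_hom)
    (use questions in \<open>auto simp: coarse_gen_def fibre_def intro!: free_carrier_sum gen_in_free_carrier\<close>)

lemma Phi_in_F: "p \<in> carrier target.F \<Longrightarrow> Phi p \<in> carrier source.F"
  by (rule ring_hom_closed[OF ring_hom_ring.homh[OF Phi_ring_hom]])

lemma coarse_gen_self_adjoint:
  assumes x: "x \<in> Questions_A G2"
  shows "coarse_gen (x, a) - free_star (coarse_gen (x, a)) \<in> source.I"
proof -
  have "gen (g x) a' - free_star (gen (g x) a') \<in> source.I" if "a' \<in> Answers_A G" for a'
    using that x questions by (intro source.gen_self_adjoint_in_ideal) auto
  then have "(\<Sum>a'\<in>fibre f (Answers_A G) a. gen (g x) a' - free_star (gen (g x) a')) \<in> source.I"
    by (intro source.game_ideal_sum) (simp add: fibre_def)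
  then show ?thesis
    by (simp add: coarse_gen_def free_star_sum sum_subtractf)
qed

text \<open>
  The product expands into products of generators whose answers lie over \<open>a\<close> and \<open>b\<close>. All of them
  are losing in the source game, since a winning one would make \<open>(x, y, a, b)\<close> winning.
\<close>

lemma coarse_gen_orthogonal:
  assumes "x \<in> Questions_A G2" "y \<in> Questions_A G2" and "\<not> wins G2 x y a b"
  shows "coarse_gen (x, a) * coarse_gen (y, b) \<in> source.I"
proof -
  have "gen (g x) a' * gen (g y) b' \<in> source.I"
    if "a' \<in> fibre f (Answers_A G) a" "b' \<in> fibre f (Answers_A G) b" for a' b'
  proof -
    have "\<not> wins G (g x) (g y) a' b'"
      using that assms wins_relabel by (auto simp: fibre_def)
    then show ?thesis
      using that assms questions
      by (intro source.gen_orthogonal_in_ideal) (auto simp: fibre_def)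
  qed
  then show ?thesis
    by (simp add: coarse_gen_def sum_product source.game_ideal_sum)
qed

text \<open>
  Modulo the ideal, the diagonal terms of the square reproduce the sum, and the mixed terms vanish
  because the game is lost by distinct answers to the same question. This has to come from the game:
  in a general *-algebra, projections that sum to one need not be orthogonal.
\<close>

lemma coarse_gen_idempotent:
  assumes x: "x \<in> Questions_A G2"
  shows "coarse_gen (x, a) - coarse_gen (x, a) * coarse_gen (x, a) \<in> source.I"
proof -
  let ?S = "fibre f (Answers_A G) a" and ?e = "gen (g x)"
  have gx: "g x \<in> Questions_A G"
    using x questions by auto
  have "?e b - (\<Sum>c\<in>?S. ?e b * ?e c) \<in> source.I" if b: "b \<in> ?S" for b
  proof -
    have "?e b * ?e c \<in> source.I" if "c \<in> ?S - {b}" for c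
    proof -
      have "\<not> wins G (g x) (g x) b c"
        using that b gx synchronous by (auto simp: fibre_def)
      then show ?thesis
        using that b gx by (intro source.gen_orthogonal_in_ideal) (auto simp: fibre_def)
    qed
    then have "(\<Sum>c\<in>?S - {b}. ?e b * ?e c) \<in> source.I"
      by (rule source.game_ideal_sum)
    moreover have "?e b - ?e b * ?e b \<in> source.I"
      using b gx by (intro source.gen_idempotent_in_ideal) (auto simp: fibre_def)
    ultimately have "?e b - ?e b * ?e b - (\<Sum>c\<in>?S - {b}. ?e b * ?e c) \<in> source.I"
      by (rule source.game_ideal_diff[rotated])
    then show ?thesis
      using b source.finite_answers by (simp add: sum.remove[of ?S b] diff_diff_eq)
  qed
  then have "(\<Sum>b\<in>?S. ?e b - (\<Sum>c\<in>?S. ?e b * ?e c)) \<in> source.I"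
    by (rule source.game_ideal_sum)
  then show ?thesis
    by (simp add: coarse_gen_def sum_product sum_subtractf)
qed

lemma coarse_gen_complete:
  assumes x: "x \<in> Questions_A G2"
  shows "(\<Sum>a\<in>Answers_A G2. coarse_gen (x, a)) - 1 \<in> source.I"
proof -
  have "(\<Sum>a\<in>Answers_A G. gen (g x) a) - 1 \<in> source.I"
    using x questions by (intro source.gen_complete_in_ideal) auto
  then show ?thesis
    using answers source.finite_answers target.finite_answers
    by (simp add: coarse_gen_def sum_fibres)
qed

text \<open>
  The preimage of the ideal of \<open>G\<close> is a *-ideal that contains the relations of \<open>G2\<close>, so it
  contains the least such ideal.
\<close>

lemma Phi_game_ideal: "p \<in> target.I \<Longrightarrow> Phi p \<in> source.I"
proof -
  let ?J = "{p \<in> carrier target.F. Phi p \<in> source.I}"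
  have "target.I \<subseteq> ?J"
  proof (rule target.game_ideal_least)
    show "ideal ?J target.F"
      by (rule ring_hom_ring.ideal_vimage[OF Phi_ring_hom source.ideal_game_ideal])
    show "free_star ` ?J \<subseteq> ?J"
      by (auto simp: free_hom_star game_free_algebra_def intro: free_carrier_star source.star_game_ideal)
    have "Phi r \<in> source.I" if "r \<in> game_relations G2" for r
      using that coarse_gen_self_adjoint coarse_gen_idempotent coarse_gen_complete
        coarse_gen_orthogonal
      unfolding game_relations_def target.same_questions target.same_answers
      by (auto simp: free_hom_diff free_hom_mult free_hom_star free_hom_sum free_hom_one free_hom_gen)
    then show "game_relations G2 \<subseteq> ?J"
      using target.game_relations_in_F by blast
  qed
  then show "p \<in> target.I \<Longrightarrow> Phi p \<in> source.I"
    by blast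
qed

text \<open>
  A game algebra is zero iff \<open>1\<close> lies in the ideal, and \<open>Phi\<close> maps \<open>1\<close> to \<open>1\<close>.
\<close>

lemma relabel_Astar:
  assumes "carrier (game_algebra G) \<noteq> {\<zero>\<^bsub>game_algebra G\<^esub>}"
  shows "carrier (game_algebra G2) \<noteq> {\<zero>\<^bsub>game_algebra G2\<^esub>}"
proof
  assume "carrier (game_algebra G2) = {\<zero>\<^bsub>game_algebra G2\<^esub>}"
  then have "1 \<in> target.I"
    by (simp only: target.game_algebra_trivial_iff)
  then have "1 \<in> source.I"
    using Phi_game_ideal[of 1] by (simp only: free_hom_one)
  with assms show False
    by (simp only: source.game_algebra_trivial_iff not_True_eq_False)
qed

text \<open>
  The homomorphism of quotients induced by \<open>Phi\<close>. All elements of a coset have the same image coset,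
  so the union is in fact a single coset.
\<close>

definition coset_map :: "('x2 \<times> 'a2) free_elem set \<Rightarrow> ('x \<times> 'a) free_elem set"
  where "coset_map U = (\<Union>p\<in>U. source.coset (Phi p))"

lemma coset_map_coset: "coset_map (target.coset p) = source.coset (Phi p)"
proof -
  have "source.coset (Phi q) = source.coset (Phi p)" if "q \<in> target.coset p" for q
    using that Phi_game_ideal
    by (intro source.coset_eqI) (auto simp: target.coset_iff free_hom_add)
  moreover have "p \<in> target.coset p"
    using target.game_ideal_zero by (force simp: target.coset_iff)
  then have "target.coset p \<noteq> {}"
    by (metis empty_iff)
  ultimately show ?thesis
    unfolding coset_map_def by (intro SUP_eq_const)
qed

lemma relabel_representation:
  assumes "unital_star_representation G \<pi>"
  shows "unital_star_representation G2 (\<pi> \<circ> coset_map)"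
  using assms Phi_in_F
  unfolding unital_star_representation_iff[OF source.synchronous_game_axioms]
    unital_star_representation_iff[OF target.synchronous_game_axioms] Let_def
  by (simp add: coset_map_coset free_hom_add free_hom_mult free_hom_one free_hom_scalar
      free_hom_star)

end

subsection \<open>Transfer of perfect strategies\<close>

context game_relabelling
begin

sublocale corr: relabelling
  "Questions_A G" "Questions_A G" "Answers_A G" "Answers_A G"
  "Questions_A G2" "Questions_A G2" "Answers_A G2" "Answers_A G2" g g f f
  by standard (use questions answers source.finite_answers target.finite_answers in auto)

text \<open>
  The probability of a losing combination is a sum over its fibre, which consists of losing
  combinations of the source game only.
\<close>

lemma relabel_perfect:
  assumes nonempty: "perfect_for G C \<noteq> {}" and preserved: "\<And>p. p \<in> C \<Longrightarrow> corr.relabel p \<in> C2"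
  shows "perfect_for G2 C2 \<noteq> {}"
proof -
  obtain p where p: "p \<in> C"
    and zero: "\<And>x y a b. x \<in> Questions_A G \<Longrightarrow> y \<in> Questions_A G \<Longrightarrow>
      a \<in> Answers_A G \<Longrightarrow> b \<in> Answers_A G \<Longrightarrow> \<not> wins G x y a b \<Longrightarrow> p x y a b = 0"
    using nonempty unfolding perfect_for_def source.same_questions source.same_answers by blast
  have "corr.relabel p x y a b = 0"
    if xy: "x \<in> Questions_A G2" "y \<in> Questions_A G2" and lose: "\<not> wins G2 x y a b" for x y a b
  proof -
    have "p (g x) (g y) a' b' = 0"
      if "a' \<in> fibre f (Answers_A G) a" "b' \<in> fibre f (Answers_A G) b" for a' b'
    proof (rule zero)
      show "\<not> wins G (g x) (g y) a' b'"
        using that xy lose wins_relabel by (auto simp: fibre_def)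
    qed (use that xy questions in \<open>auto simp: fibre_def\<close>)
    then show ?thesis
      by (simp add: relabel_correlation_def)
  qed
  then have "corr.relabel p \<in> perfect_for G2 C2"
    using preserved[OF p]
    by (simp add: perfect_for_def target.same_questions target.same_answers)
  then show ?thesis
    by blast
qed

theorem perfect_strategy_relabel:
  assumes strategy: "has_perfect_strategy TYPE('h::complex_hilbert_space) t G"
  shows "has_perfect_strategy TYPE('h) t G2"
proof (cases t)
  case T_loc
  with strategy show ?thesis
    using relabel_perfect[OF _ corr.relabel_C_loc]
    by (simp add: source.same_questions source.same_answers target.same_questions
        target.same_answers)
next
  case T_q
  with strategy show ?thesis
    using relabel_perfect[OF _ corr.relabel_C_q]
    by (simp add: source.same_questions source.same_answers target.same_questions
        target.same_answers)
next
  case T_qa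
  with strategy show ?thesis
    using relabel_perfect[OF _ corr.relabel_C_qa]
    by (simp add: source.same_questions source.same_answers target.same_questions
        target.same_answers)
next
  case T_qc
  with strategy show ?thesis
    using relabel_perfect[OF _ corr.relabel_C_qc[where 'h = 'h]]
    by (simp add: source.same_questions source.same_answers target.same_questions
        target.same_answers)
next
  case T_Cstar
  with strategy show ?thesis
    using relabel_representation by auto
next
  case T_Astar
  with strategy show ?thesis
    using relabel_Astar by simp
qed

end

section \<open>From hypergraph isomorphism to graph isomorphism\<close>

lemma vertex_relation_graph:
  assumes "\<forall>e\<in>E. card e = 2"
  shows "vertex_relation E v w = adjacency_relation E v w"
proof -
  have "e = {v, w}" if "e \<in> E" "v \<in> e" "w \<in> e" "v \<noteq> w" for e
  proof -
    have "card e = 2"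
      using assms that by blast
    then show ?thesis
      using that by (auto simp: card_2_iff)
  qed
  then show ?thesis
    unfolding vertex_relation_def adjacency_relation_def by (auto split: if_splits)
qed

text \<open>
  For equal questions, the elements on the side of the question coincide, so the rule forces
  the elements on the other side, which are the answers, to coincide.
\<close>

lemma hyp_iso_rule_synchronous:
  assumes "hyp_iso_rule E1 E2 x x a b"
  shows "a = b"
proof (cases x)
  case (Inl x')
  with assms obtain a' b' where "a = Inl a'" "b = Inl b'"
    by (cases a; cases b) auto
  with assms Inl show ?thesis
    by (cases x'; cases a'; cases b')
      (auto simp: opposite_def left_of_def right_of_def vertex_relation_def split: if_splits)
next
  case (Inr x')
  with assms obtain a' b' where "a = Inr a'" "b = Inr b'"
    by (cases a; cases b) auto
  with assms Inr show ?thesis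
    by (cases x'; cases a'; cases b')
      (auto simp: opposite_def left_of_def right_of_def edge_relation_def split: if_splits)
qed

theorem corollary3p11:
  fixes V1 :: "'v set" and E1 :: "'v set set"
    and V2 :: "'w set" and E2 :: "'w set set"
    and t :: strategy_type
  assumes "simple_graph V1 E1" and "simple_graph V2 E2"
    and "hypergraph V1 E1" and "hypergraph V2 E2"
    and "has_perfect_strategy TYPE('h::complex_hilbert_space) t (HypIso V1 E1 V2 E2)"
  shows "has_perfect_strategy TYPE('h) t (Iso V1 E1 V2 E2)"
proof -
  have finite: "finite V1" "finite V2" "finite E1" "finite E2"
    using assms by (auto simp: hypergraph_def intro: finite_subset)
  have card: "\<forall>e\<in>E1. card e = 2" "\<forall>e\<in>E2. card e = 2"
    using assms by (auto simp: simple_graph_def)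
  have "V1 \<noteq> {}"
    using assms(1,3) by (force simp: hypergraph_def simple_graph_def)
  then obtain v where v: "v \<in> V1"
    by blast
  \<comment> \<open>Hyperedge answers are merged into the vertex \<open>v\<close>. Any vertex would do: such answers to vertex
    questions lose, so they contribute no winning combination that would have to be preserved.\<close>
  define f :: "('v, 'w) hyp_question \<Rightarrow> 'v + 'w" where "f = case_sum id (\<lambda>_. Inl v)"
  interpret game_relabelling "HypIso V1 E1 V2 E2" "Iso V1 E1 V2 E2" Inl f
  proof
    fix x y :: "'v + 'w" and a b
    assume "wins (HypIso V1 E1 V2 E2) (Inl x) (Inl y) a b"
    then show "wins (Iso V1 E1 V2 E2) x y (f a) (f b)"
      by (cases a; cases b)
        (simp_all add: HypIso_def Iso_def Let_def f_def vertex_relation_graph[OF card(1)]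
          vertex_relation_graph[OF card(2)])
  next
    fix x a b
    assume "wins (HypIso V1 E1 V2 E2) x x a b"
    then show "a = b"
      by (simp add: HypIso_def Let_def hyp_iso_rule_synchronous)
  qed (use finite v in \<open>auto simp: HypIso_def Iso_def Let_def f_def\<close>)
  show ?thesis
    by (rule perfect_strategy_relabel[OF assms(5)])
qed

end
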